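(* Let $(X,\{R_i\}_{i=0}^d)$ be an association scheme (not necessarily commutative) with adjacency matrices $A_0,\dots,A_d$, adjacency algebra $\mathcal{A}\cong\bigoplus_{k=1}^n\mathrm{Mat}_{d_k}(\mathbb{C})$, dual basis $E_{i,j}^{(k)}$ and coefficients $p_{(i,j),l}^{(k)}$ as in the context. Let $\{\Lambda_0,\Lambda_1,\ldots,\Lambda_e\}$ be a partition of $\{0,1,\ldots,d\}$ such that $\Lambda_0=\{0\}$. Assume: (a) for any $l\in\{0,1,\ldots,e\}$ there exists $k\in\{0,1,\ldots,e\}$ such that $\sum_{l'\in\Lambda_l}A_{l'}^\top=\sum_{k'\in\Lambda_k}A_{k'}$; and (b) for every $k\in\{1,\ldots,n\}$ there exists a canonical partition $\{\mathcal{I}_{a,b}^{(k)}\mid a,b\in\{1,\ldots,f_k\}\}$ of $\{1,\ldots,d_k\}^2$ such that $\sum_{k=1}^n f_k^2=e+1$ and, for all $l\in\{0,\ldots,e\}$, $k\in\{1,\ldots,n\}$ and $a,b\in\{1,\ldots,f_k\}$, the sum $\sum_{l'\in\Lambda_l}p_{(i,j),l'}^{(k)}$ does not depend on the choice of $(i,j)\in\mathcal{I}_{a,b}^{(k)}$. Then $(X,\{\bigcup_{l'\in\Lambda_l}R_{l'}\}_{l=0}^e)$ is a fusion scheme of $(X,\{R_i\}_{i=0}^d)$, i.e. it is an association scheme.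
   Context: Association scheme: let $X$ be a finite set of size $v$, $d$ a positive integer, and $R_0,\dots,R_d$ nonempty subsets of $X\times X$; $A_i$ is the $v\times v$ $(0,1)$-matrix with $(A_i)_{xy}=1$ iff $(x,y)\in R_i$. The pair $(X,\{R_i\}_{i=0}^d)$ is an association scheme (of $d$-class) if (i) $A_0=I_v$; (ii) $\sum_{i=0}^dA_i=J_v$ (all-ones matrix); (iii) $A_i^\top\in\{A_1,\dots,A_d\}$ for every $i\in\{1,\dots,d\}$; (iv) for all $i,j$, $A_iA_j$ is a linear combination of $A_0,\dots,A_d$. Adjacency algebra: $\mathcal{A}=\mathrm{span}_{\mathbb{C}}\{A_0,\dots,A_d\}$. It is semisimple, so $\mathcal{A}\cong\bigoplus_{k=1}^n\mathrm{Mat}_{d_k}(\mathbb{C})$ for uniquely determined positive integers $n,d_1,\dots,d_n$. Put $\mathcal{I}=\{(i,j,k)\mid 1\le i,j\le d_k,\ 1\le k\le n\}$. Dual basis: $\{E_{i,j}^{(k)}\}_{(i,j,k)\in\mathcal{I}}$ is a fixed basis of $\mathcal{A}$ satisfying $E_{i,j}^{(k)}E_{i',j'}^{(k')}=\delta_{k,k'}\delta_{j,i'}E_{i,j'}^{(k)}$ and $(E_{i,j}^{(k)})^*=E_{j,i}^{(k)}$ ($*$ = conjugate transpose), where the superscript $k$ corresponds to the $k$-th simple component. The complex numbers $p_{(i,j),l}^{(k)}$ are defined by $A_l=\sum_{(i,j,k)\in\mathcal{I}}p_{(i,j),l}^{(k)}E_{i,j}^{(k)}$. Canonical partition: for a given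 $k$, let $\{I_1^{(k)},\dots,I_{f_k}^{(k)}\}$ be a partition of $\{1,\dots,d_k\}$ and set $\mathcal{I}_{a,b}^{(k)}=I_a^{(k)}\times I_b^{(k)}$ for $a,b\in\{1,\dots,f_k\}$. The partition of $\{1,\dots,d_k\}^2$ into these sets is called canonical. Parts of partitions are nonempty. Fusion scheme: if $(X,\{\bigcup_{l'\in\Lambda_l}R_{l'}\}_{l=0}^e)$ is an association scheme, it is called a fusion scheme of $(X,\{R_i\}_{i=0}^d)$. *)

theory Defs
  imports "HOL-Analysis.Analysis"
begin

text \<open>
  The finite set \<open>X\<close> is the universe of a finite type \<open>'x\<close>, so that complex matrices indexed by
  \<open>X \<times> X\<close> are the library's \<^typ>\<open>complex^'x^'x\<close>, with product \<open>**\<close>, transpose and identity \<open>mat 1\<close>.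
\<close>

text \<open>The library's \<open>*s\<close> scales vectors only; on matrices it would act with vector scalars.\<close>

definition mscale :: "complex \<Rightarrow> complex^'x^'x \<Rightarrow> complex^'x^'x"  (infixr "*\<^sub>m" 75)
  where "c *\<^sub>m A = (\<chi> x y. c * A $ x $ y)"

global_interpretation cmat: vector_space "mscale :: complex \<Rightarrow> complex^'x^'x \<Rightarrow> complex^'x^'x"
  by unfold_locales (simp_all add: mscale_def vec_eq_iff algebra_simps)

definition conj_transpose :: "complex^'x^'x \<Rightarrow> complex^'x^'x"
  where "conj_transpose A = (\<chi> x y. cnj (A $ y $ x))"

definition adj_matrix :: "('x::finite \<times> 'x) set \<Rightarrow> complex^'x^'x"
  where "adj_matrix r = (\<chi> x y. if (x, y) \<in> r then 1 else 0)"

definition adjacency_algebra :: "nat \<Rightarrow> (nat \<Rightarrow> ('x::finite \<times> 'x) set) \<Rightarrow> (complex^'x^'x) set"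
  where "adjacency_algebra d R = cmat.span ((\<lambda>i. adj_matrix (R i)) ` {0..d})"

text \<open>Only the values \<open>R 0, \<dots>, R d\<close> are relevant.\<close>

definition association_scheme :: "nat \<Rightarrow> (nat \<Rightarrow> ('x::finite \<times> 'x) set) \<Rightarrow> bool"
  where "association_scheme d R \<longleftrightarrow>
    d \<ge> 1 \<and>
    (\<forall>i\<in>{0..d}. R i \<noteq> {}) \<and>
    adj_matrix (R 0) = mat 1 \<and>
    (\<Sum>i\<in>{0..d}. adj_matrix (R i)) = (\<chi> x y. 1) \<and>
    (\<forall>i\<in>{1..d}. transpose (adj_matrix (R i)) \<in> (\<lambda>j. adj_matrix (R j)) ` {1..d}) \<and>
    (\<forall>i\<in>{0..d}. \<forall>j\<in>{0..d}.
       adj_matrix (R i) ** adj_matrix (R j) \<in> cmat.span ((\<lambda>l. adj_matrix (R l)) ` {0..d}))"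

text \<open>
  The index set of all \<open>(i, j, k)\<close> with \<open>1 \<le> i, j \<le> dm k\<close> and \<open>1 \<le> k \<le> n\<close>; the function \<open>dm\<close>
  gives the sizes of the simple components.
\<close>

definition block_index :: "nat \<Rightarrow> (nat \<Rightarrow> nat) \<Rightarrow> (nat \<times> nat \<times> nat) set"
  where "block_index n dm = {(i, j, k). i \<in> {1..dm k} \<and> j \<in> {1..dm k} \<and> k \<in> {1..n}}"

text \<open>
  The direct sum of the full matrix algebras of sizes \<open>dm 1, \<dots>, dm n\<close>: the \<open>(i, j)\<close> entry of the
  \<open>k\<close>-th summand of \<open>B\<close> is \<open>B (i, j, k)\<close>, and \<open>B\<close> is zero outside the index set.
\<close>

definition block_algebra :: "nat \<Rightarrow> (nat \<Rightarrow> nat) \<Rightarrow> (nat \<times> nat \<times> nat \<Rightarrow> complex) set"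
  where "block_algebra n dm = {B. \<forall>t. t \<notin> block_index n dm \<longrightarrow> B t = 0}"

definition block_one ::
    "nat \<Rightarrow> (nat \<Rightarrow> nat) \<Rightarrow> nat \<times> nat \<times> nat \<Rightarrow> complex"
  where "block_one n dm = (\<lambda>(i, j, k). if (i, j, k) \<in> block_index n dm \<and> i = j then 1 else 0)"

definition block_mult ::
    "(nat \<Rightarrow> nat) \<Rightarrow> (nat \<times> nat \<times> nat \<Rightarrow> complex) \<Rightarrow> (nat \<times> nat \<times> nat \<Rightarrow> complex) \<Rightarrow>
      nat \<times> nat \<times> nat \<Rightarrow> complex"
  where "block_mult dm B C = (\<lambda>(i, j, k). \<Sum>m\<in>{1..dm k}. B (i, m, k) * C (m, j, k))"

text \<open>
  \<open>\<phi>\<close> is an isomorphism of unital complex algebras from the matrix algebra \<open>\<A>\<close> onto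
  \<^const>\<open>block_algebra\<close>.
\<close>

definition wedderburn_iso ::
    "(complex^'x::finite^'x) set \<Rightarrow> nat \<Rightarrow> (nat \<Rightarrow> nat) \<Rightarrow>
      (complex^'x^'x \<Rightarrow> nat \<times> nat \<times> nat \<Rightarrow> complex) \<Rightarrow> bool"
  where "wedderburn_iso \<A> n dm \<phi> \<longleftrightarrow>
    n \<ge> 1 \<and> (\<forall>k\<in>{1..n}. dm k \<ge> 1) \<and>
    bij_betw \<phi> \<A> (block_algebra n dm) \<and>
    (\<forall>A\<in>\<A>. \<forall>B\<in>\<A>. \<phi> (A + B) = (\<lambda>t. \<phi> A t + \<phi> B t)) \<and>
    (\<forall>c. \<forall>A\<in>\<A>. \<phi> (c *\<^sub>m A) = (\<lambda>t. c * \<phi> A t)) \<and>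
    (\<forall>A\<in>\<A>. \<forall>B\<in>\<A>. \<phi> (A ** B) = block_mult dm (\<phi> A) (\<phi> B)) \<and>
    \<phi> (mat 1) = block_one n dm"

text \<open>
  The last conjunct says that \<open>E (i, j, k)\<close> lies in the \<open>k\<close>-th simple component of \<open>\<A>\<close>.
\<close>

definition dual_basis ::
    "(complex^'x::finite^'x) set \<Rightarrow> nat \<Rightarrow> (nat \<Rightarrow> nat) \<Rightarrow>
      (complex^'x^'x \<Rightarrow> nat \<times> nat \<times> nat \<Rightarrow> complex) \<Rightarrow>
      (nat \<times> nat \<times> nat \<Rightarrow> complex^'x^'x) \<Rightarrow> bool"
  where "dual_basis \<A> n dm \<phi> E \<longleftrightarrow>
    inj_on E (block_index n dm) \<and>
    cmat.independent (E ` block_index n dm) \<and>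
    cmat.span (E ` block_index n dm) = \<A> \<and>
    (\<forall>(i, j, k)\<in>block_index n dm. \<forall>(i', j', k')\<in>block_index n dm.
       E (i, j, k) ** E (i', j', k') = (if k = k' \<and> j = i' then E (i, j', k) else 0)) \<and>
    (\<forall>(i, j, k)\<in>block_index n dm. conj_transpose (E (i, j, k)) = E (j, i, k)) \<and>
    (\<forall>(i, j, k)\<in>block_index n dm. \<forall>(i', j', k')\<in>block_index n dm.
       k' \<noteq> k \<longrightarrow> \<phi> (E (i, j, k)) (i', j', k') = 0)"

text \<open>
  Injectivity makes the parts indexed by distinct elements of \<open>J\<close> distinct;
  \<^const>\<open>partition_on\<close> requires nonempty parts.
\<close>

definition indexed_partition :: "'a set \<Rightarrow> 'i set \<Rightarrow> ('i \<Rightarrow> 'a set) \<Rightarrow> bool"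
  where "indexed_partition S J P \<longleftrightarrow> partition_on S (P ` J) \<and> inj_on P J"

definition canonical_partition :: "nat \<Rightarrow> nat \<Rightarrow> (nat \<Rightarrow> nat \<Rightarrow> (nat \<times> nat) set) \<Rightarrow> bool"
  where "canonical_partition m f C \<longleftrightarrow>
    (\<exists>I. indexed_partition {1..m} {1..f} I \<and>
         (\<forall>a\<in>{1..f}. \<forall>b\<in>{1..f}. C a b = I a \<times> I b))"

definition fusion_scheme ::
    "nat \<Rightarrow> (nat \<Rightarrow> ('x::finite \<times> 'x) set) \<Rightarrow> nat \<Rightarrow> (nat \<Rightarrow> nat set) \<Rightarrow> bool"
  where "fusion_scheme d R e \<Lambda> \<longleftrightarrow>
    association_scheme d R \<and>
    indexed_partition {0..d} {0..e} \<Lambda> \<and>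
    association_scheme e (\<lambda>l. \<Union>l'\<in>\<Lambda> l. R l')"

end

theory Submission
  imports Defs
begin

text \<open>
  The proof is a dimension count. Write \<open>B l\<close> for the sum of the \<open>A l'\<close> over \<open>l' \<in> \<Lambda> l\<close>, which is the
  adjacency matrix of the \<open>l\<close>-th fused relation. For each block \<open>I a \<times> I b\<close> of the canonical
  partition of the \<open>k\<close>-th component, let \<open>F k a b\<close> be the sum of the \<open>E (i, j, k)\<close> over
  \<open>(i, j) \<in> I a \<times> I b\<close>. The dual basis multiplies like matrix units, hence so do the block sums, up
  to a scalar: \<open>F k a b ** F k b c\<close> is \<open>card (I b)\<close> times \<open>F k a c\<close>, and all other products vanish
  (\<open>block_sum_mult\<close>). So the span \<open>W\<close> of the block sums is closed under multiplication.

  The constancy of the coefficients on blocks says exactly that every \<open>B l\<close> lies in \<open>W\<close>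
  (\<open>block_constant_sum_in_span\<close>). The fused relations are nonempty and pairwise disjoint, so the
  \<open>e + 1\<close> matrices \<open>B l\<close> are linearly independent (\<open>adj_matrix_disjoint_independent\<close>), while \<open>W\<close> is
  spanned by at most \<open>\<Sum>k. (f k)\<^sup>2 = e + 1\<close> matrices. By the exchange lemma the \<open>B l\<close> span \<open>W\<close>. Thus
  products of the \<open>B l\<close>, which lie in \<open>W\<close>, are linear combinations of the \<open>B l\<close>. Closure under
  transposition is hypothesis (a), and the remaining axioms are inherited from the given scheme.
\<close>

section \<open>Indexed partitions\<close>

lemma indexed_partition_UN: "indexed_partition S J P \<Longrightarrow> (\<Union>j\<in>J. P j) = S"
  by (simp add: indexed_partition_def partition_on_def)

lemma indexed_partition_nonempty: "indexed_partition S J P \<Longrightarrow> j \<in> J \<Longrightarrow> P j \<noteq> {}"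
  by (auto simp: indexed_partition_def partition_on_def)

lemma indexed_partition_disjoint:
  "indexed_partition S J P \<Longrightarrow> disjoint_family_on P J"
  unfolding indexed_partition_def partition_on_def disjoint_family_on_def
  by (metis disjointD imageI inj_onD)

lemma indexed_partition_subset: "indexed_partition S J P \<Longrightarrow> j \<in> J \<Longrightarrow> P j \<subseteq> S"
  using indexed_partition_UN by blast

lemma sum_indexed_partition:
  assumes "indexed_partition S J P" "finite S" "finite J"
  shows "sum g S = (\<Sum>a\<in>J. sum g (P a))"
proof -
  have "finite (P a)" if "a \<in> J" for a
    using indexed_partition_subset[OF assms(1) that] assms(2) by (rule finite_subset)
  then have "sum g (\<Union>a\<in>J. P a) = (\<Sum>a\<in>J. sum g (P a))"
    using assms(3) indexed_partition_disjoint[OF assms(1)]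
    by (intro sum.UNION_disjoint) (auto simp: disjoint_family_on_def)
  then show ?thesis
    using indexed_partition_UN[OF assms(1)] by simp
qed

section \<open>Spans of matrices\<close>

lemma matrix_add_rdistrib: "(A + B) ** (C :: complex^'x::finite^'x) = A ** C + B ** C"
  by (simp add: matrix_matrix_mult_def vec_eq_iff distrib_right sum.distrib)

lemma matrix_mult_sum_left: "(\<Sum>a\<in>J. g a) ** (M :: complex^'x::finite^'x) = (\<Sum>a\<in>J. g a ** M)"
  by (induction J rule: infinite_finite_induct) (auto simp: matrix_add_rdistrib)

lemma matrix_mult_sum_right: "(M :: complex^'x::finite^'x) ** (\<Sum>a\<in>J. g a) = (\<Sum>a\<in>J. M ** g a)"
  by (induction J rule: infinite_finite_induct) (auto simp: matrix_add_ldistrib)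

lemma mscale_mult_left: "(c *\<^sub>m A) ** B = c *\<^sub>m (A ** (B :: complex^'x::finite^'x))"
  by (simp add: mscale_def matrix_matrix_mult_def vec_eq_iff sum_distrib_left mult.assoc)

lemma mscale_mult_right: "A ** (c *\<^sub>m B) = c *\<^sub>m (A ** (B :: complex^'x::finite^'x))"
  by (simp add: mscale_def matrix_matrix_mult_def vec_eq_iff sum_distrib_left mult.left_commute)

lemma span_mult_closed:
  fixes S :: "(complex^'x::finite^'x) set"
  assumes "\<And>A B. A \<in> S \<Longrightarrow> B \<in> S \<Longrightarrow> A ** B \<in> cmat.span S"
    and "A \<in> cmat.span S" "B \<in> cmat.span S"
  shows "A ** B \<in> cmat.span S"
proof -
  have *: "A ** B \<in> cmat.span S" if "A \<in> S" for A
    using assms(3)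
    by (induction rule: cmat.span_induct_alt)
      (auto simp: matrix_add_ldistrib mscale_mult_right
        intro!: cmat.span_add cmat.span_scale cmat.span_zero assms(1) that)
  show ?thesis
    using assms(2)
    by (induction rule: cmat.span_induct_alt)
      (auto simp: matrix_add_rdistrib mscale_mult_left
        intro!: cmat.span_add cmat.span_scale cmat.span_zero *)
qed

text \<open>
  A vector of \<open>span T\<close> outside \<open>span S\<close> would extend \<open>S\<close> to an independent subset of \<open>span T\<close> with
  more than \<open>card T\<close> elements, against the exchange lemma.
\<close>

lemma span_subset_independent_card:
  fixes S T :: "(complex^'x::finite^'x) set"
  assumes "finite T" "cmat.independent S" "S \<subseteq> cmat.span T" "card T \<le> card S"
  shows "cmat.span T \<subseteq> cmat.span S"
proof (rule subsetI, rule ccontr)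
  fix x assume x: "x \<in> cmat.span T" "x \<notin> cmat.span S"
  then have "cmat.independent (insert x S)"
    using assms(2) by (simp add: cmat.independent_insertI)
  then have *: "finite (insert x S)" "card (insert x S) \<le> card T"
    using cmat.independent_span_bound[of T "insert x S"] assms(1,3) x(1) by auto
  have "x \<notin> S"
    using x(2) cmat.span_base by blast
  with * assms(4) show False by simp
qed

section \<open>Adjacency matrices of disjoint relations\<close>

lemma adj_matrix_UN:
  assumes "finite J" "disjoint_family_on S J"
  shows "adj_matrix (\<Union>j\<in>J. S j) = (\<Sum>j\<in>J. adj_matrix (S j))"
proof -
  have "(if \<exists>j\<in>J. (x, y) \<in> S j then 1 else 0) = (\<Sum>j\<in>J. if (x, y) \<in> S j then 1 else (0::complex))"
    for x y
  proof (cases "\<exists>j\<in>J. (x, y) \<in> S j")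
    case True
    then obtain i where i: "i \<in> J" "(x, y) \<in> S i" by blast
    then have "(\<Sum>j\<in>J. if (x, y) \<in> S j then 1 else (0::complex)) = (\<Sum>j\<in>J. if j = i then 1 else 0)"
      using assms(2) by (intro sum.cong) (auto simp: disjoint_family_on_def)
    then show ?thesis using i assms(1) by auto
  qed auto
  then show ?thesis
    by (simp add: adj_matrix_def vec_eq_iff)
qed

lemma association_scheme_disjoint:
  assumes "association_scheme d R"
  shows "disjoint_family_on R {0..d}"
  unfolding disjoint_family_on_def
proof (intro ballI impI equals0I)
  fix i j z assume ij: "i \<in> {0..d}" "j \<in> {0..d}" "i \<noteq> j" "z \<in> R i \<inter> R j"
  obtain x y where z: "z = (x, y)" by force
  have "(\<Sum>i\<in>{0..d}. adj_matrix (R i)) $ x $ y = 1"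
    using assms by (simp add: association_scheme_def)
  then have "(\<Sum>i\<in>{0..d}. if (x, y) \<in> R i then 1 else (0::complex)) = 1"
    by (simp add: adj_matrix_def)
  then have "card {i \<in> {0..d}. (x, y) \<in> R i} = 1"
    by (simp add: sum.If_cases Int_def)
  moreover have "card {i, j} \<le> card {i \<in> {0..d}. (x, y) \<in> R i}"
    using ij z by (intro card_mono) auto
  ultimately have "card {i, j} \<le> 1" by simp
  then show False using ij by simp
qed

text \<open>
  Independence and dimension concern the set of matrices; injectivity lets its cardinality and the
  sums over it be computed from the index set.
\<close>

lemma adj_matrix_disjoint_inj:
  assumes "disjoint_family_on S J" "\<And>j. j \<in> J \<Longrightarrow> S j \<noteq> {}"
  shows "inj_on (\<lambda>j. adj_matrix (S j)) J"
proof (rule inj_onI)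
  fix i j assume ij: "i \<in> J" "j \<in> J" and eq: "adj_matrix (S i) = adj_matrix (S j)"
  obtain x y where "(x, y) \<in> S i" using assms(2)[OF ij(1)] by fast
  moreover have "adj_matrix (S i) $ x $ y = adj_matrix (S j) $ x $ y" using eq by simp
  ultimately have "(x, y) \<in> S j" by (simp add: adj_matrix_def split: if_splits)
  with \<open>(x, y) \<in> S i\<close> show "i = j"
    using assms(1) ij by (auto simp: disjoint_family_on_def)
qed

text \<open>The entry of a linear combination at a position in \<open>S j\<close> is the coefficient of \<open>S j\<close>.\<close>

lemma adj_matrix_disjoint_independent:
  assumes "finite J" "disjoint_family_on S J" "\<And>j. j \<in> J \<Longrightarrow> S j \<noteq> {}"
  shows "cmat.independent ((\<lambda>j. adj_matrix (S j)) ` J)"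
proof -
  have "u (adj_matrix (S i)) = 0"
    if i: "i \<in> J" and z: "(\<Sum>A\<in>(\<lambda>j. adj_matrix (S j)) ` J. u A *\<^sub>m A) = 0" for u i
  proof -
    obtain x y where xy: "(x, y) \<in> S i" using assms(3)[OF i] by fast
    have "(\<Sum>j\<in>J. u (adj_matrix (S j)) *\<^sub>m adj_matrix (S j)) = 0"
      using z by (simp add: sum.reindex[OF adj_matrix_disjoint_inj[OF assms(2,3)]])
    then have "(\<Sum>j\<in>J. u (adj_matrix (S j)) *\<^sub>m adj_matrix (S j)) $ x $ y = 0"
      by simp
    then have "(\<Sum>j\<in>J. u (adj_matrix (S j)) * adj_matrix (S j) $ x $ y) = 0"
      by (simp add: mscale_def)
    moreover have "(\<Sum>j\<in>J. u (adj_matrix (S j)) * adj_matrix (S j) $ x $ y)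
        = (\<Sum>j\<in>J. if j = i then u (adj_matrix (S i)) else 0)"
      using xy i assms(2)
      by (intro sum.cong) (auto simp: adj_matrix_def disjoint_family_on_def)
    ultimately show ?thesis using i assms(1) by simp
  qed
  then show ?thesis
    using assms(1) by (auto simp: cmat.dependent_finite)
qed

section \<open>Block sums of matrix units\<close>

definition block_sum ::
    "(nat \<times> nat \<times> nat \<Rightarrow> complex^'x^'x) \<Rightarrow> (nat \<Rightarrow> nat \<Rightarrow> nat set) \<Rightarrow> nat \<Rightarrow> nat \<Rightarrow> nat \<Rightarrow> complex^'x^'x"
  where "block_sum E I k a b = (\<Sum>i\<in>I k a. \<Sum>j\<in>I k b. E (i, j, k))"

text \<open>
  For equal middle parts, each \<open>E (i, j', k)\<close> arises once for every common middle index, that is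
  \<open>card (I k b)\<close> times; distinct middle parts are disjoint and have no common index.
\<close>

lemma block_sum_mult:
  fixes E :: "nat \<times> nat \<times> nat \<Rightarrow> complex^'x::finite^'x"
  assumes unit: "\<And>i j k i' j' k'. (i, j, k) \<in> block_index n dm \<Longrightarrow> (i', j', k') \<in> block_index n dm \<Longrightarrow>
      E (i, j, k) ** E (i', j', k') = (if k = k' \<and> j = i' then E (i, j', k) else 0)"
    and I: "\<And>k. k \<in> {1..n} \<Longrightarrow> indexed_partition {1..dm k} {1..f k} (I k)"
    and idx: "k \<in> {1..n}" "a \<in> {1..f k}" "b \<in> {1..f k}"
      "k' \<in> {1..n}" "a' \<in> {1..f k'}" "b' \<in> {1..f k'}"
  shows "block_sum E I k a b ** block_sum E I k' a' b' =
    (if k = k' \<and> b = a' then of_nat (card (I k b)) *\<^sub>m block_sum E I k a b' else 0)"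
proof -
  note sub = indexed_partition_subset[OF I]
  have fin: "finite (I k b)"
    using sub[OF idx(1,3)] finite_subset by blast
  have mult_unit: "E (i, j, k) ** E (i', j', k') = (if k = k' \<and> j = i' then E (i, j', k) else 0)"
    if "i \<in> I k a" "j \<in> I k b" "i' \<in> I k' a'" "j' \<in> I k' b'" for i j i' j'
    using that sub[OF idx(1,2)] sub[OF idx(1,3)] sub[OF idx(4,5)] sub[OF idx(4,6)] idx(1,4)
    by (intro unit) (auto simp: block_index_def)
  have "block_sum E I k a b ** block_sum E I k' a' b' =
      (\<Sum>i\<in>I k a. \<Sum>j\<in>I k b. \<Sum>i'\<in>I k' a'. \<Sum>j'\<in>I k' b'. E (i, j, k) ** E (i', j', k'))"
    unfolding block_sum_def matrix_mult_sum_left unfolding matrix_mult_sum_right ..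
  also have "\<dots> = (\<Sum>i\<in>I k a. \<Sum>j\<in>I k b. \<Sum>i'\<in>I k' a'. \<Sum>j'\<in>I k' b'.
      if k = k' \<and> j = i' then E (i, j', k) else 0)"
    by (intro sum.cong refl mult_unit)
  also have "\<dots> = (if k = k' \<and> b = a' then of_nat (card (I k b)) *\<^sub>m block_sum E I k a b' else 0)"
  proof (cases "k = k' \<and> b = a'")
    case True
    then have eqs: "k' = k" "a' = b" by auto
    have *: "(\<Sum>i'\<in>I k b. \<Sum>j'\<in>I k b'. if j = i' then E (i, j', k) else 0)
        = (\<Sum>j'\<in>I k b'. E (i, j', k))" if "j \<in> I k b" for i j
    proof -
      have "(\<Sum>i'\<in>I k b. \<Sum>j'\<in>I k b'. if j = i' then E (i, j', k) else 0)
          = (\<Sum>i'\<in>I k b. if j = i' then \<Sum>j'\<in>I k b'. E (i, j', k) else 0)"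
        by (intro sum.cong) auto
      then show ?thesis using that fin by simp
    qed
    show ?thesis
      by (simp add: eqs * cmat.sum_constant_scale block_sum_def cmat.scale_sum_right del: sum_constant)
  next
    case False
    have "I k b \<inter> I k' a' = {}" if "k = k'"
      using disjoint_family_onD[OF indexed_partition_disjoint[OF I[OF idx(1)]] idx(3), of a']
        that False idx(5) by auto
    then show ?thesis using False by (auto simp: disjoint_iff intro!: sum.neutral)
  qed
  finally show ?thesis .
qed

lemma block_constant_sum_in_span:
  fixes E :: "nat \<times> nat \<times> nat \<Rightarrow> complex^'x::finite^'x"
  assumes I: "\<And>k. k \<in> {1..n} \<Longrightarrow> indexed_partition {1..dm k} {1..f k} (I k)"
    and const: "\<And>k a b ij ij'. k \<in> {1..n} \<Longrightarrow> a \<in> {1..f k} \<Longrightarrow> b \<in> {1..f k} \<Longrightarrow>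
      ij \<in> I k a \<times> I k b \<Longrightarrow> ij' \<in> I k a \<times> I k b \<Longrightarrow> q k ij = q k ij'"
  shows "(\<Sum>(i, j, k)\<in>block_index n dm. q k (i, j) *\<^sub>m E (i, j, k))
    \<in> cmat.span ((\<lambda>(k, a, b). block_sum E I k a b) ` (SIGMA k:{1..n}. {1..f k} \<times> {1..f k}))"
    (is "_ \<in> cmat.span ?F")
proof -
  let ?g = "\<lambda>k i j. q k (i, j) *\<^sub>m E (i, j, k)"
  have "(\<Sum>(i, j, k)\<in>block_index n dm. ?g k i j)
      = (\<Sum>(k, i, j)\<in>(SIGMA k:{1..n}. {1..dm k} \<times> {1..dm k}). ?g k i j)"
    by (rule sum.reindex_bij_witness[where i="\<lambda>(k, i, j). (i, j, k)" and j="\<lambda>(i, j, k). (k, i, j)"])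
      (auto simp: block_index_def)
  also have "\<dots> = (\<Sum>k\<in>{1..n}. \<Sum>i\<in>{1..dm k}. \<Sum>j\<in>{1..dm k}. ?g k i j)"
    by (subst sum.Sigma[symmetric]) (auto intro!: sum.cong simp: sum.cartesian_product)
  also have "\<dots> = (\<Sum>k\<in>{1..n}. \<Sum>a\<in>{1..f k}. \<Sum>b\<in>{1..f k}. \<Sum>i\<in>I k a. \<Sum>j\<in>I k b. ?g k i j)"
  proof (rule sum.cong[OF refl])
    fix k assume k: "k \<in> {1..n}"
    have "(\<Sum>i\<in>{1..dm k}. \<Sum>j\<in>{1..dm k}. ?g k i j)
        = (\<Sum>a\<in>{1..f k}. \<Sum>i\<in>I k a. \<Sum>b\<in>{1..f k}. \<Sum>j\<in>I k b. ?g k i j)"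
      by (simp only: sum_indexed_partition[OF I[OF k] finite_atLeastAtMost finite_atLeastAtMost])
    also have "\<dots> = (\<Sum>a\<in>{1..f k}. \<Sum>b\<in>{1..f k}. \<Sum>i\<in>I k a. \<Sum>j\<in>I k b. ?g k i j)"
      by (rule sum.cong[OF refl]) (rule sum.swap)
    finally show "(\<Sum>i\<in>{1..dm k}. \<Sum>j\<in>{1..dm k}. ?g k i j)
        = (\<Sum>a\<in>{1..f k}. \<Sum>b\<in>{1..f k}. \<Sum>i\<in>I k a. \<Sum>j\<in>I k b. ?g k i j)" .
  qed
  also have "\<dots> \<in> cmat.span ?F"
  proof (rule cmat.span_sum, rule cmat.span_sum, rule cmat.span_sum)
    fix k a b assume kab: "k \<in> {1..n}" "a \<in> {1..f k}" "b \<in> {1..f k}"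
    have "I k a \<times> I k b \<noteq> {}"
      using indexed_partition_nonempty[OF I[OF kab(1)]] kab(2,3) by simp
    then obtain ij where ij: "ij \<in> I k a \<times> I k b" by blast
    have "(\<Sum>i\<in>I k a. \<Sum>j\<in>I k b. ?g k i j) = (\<Sum>i\<in>I k a. \<Sum>j\<in>I k b. q k ij *\<^sub>m E (i, j, k))"
      by (intro sum.cong refl arg_cong2[where f=mscale] const[OF kab _ ij]) auto
    also have "\<dots> = q k ij *\<^sub>m block_sum E I k a b"
      by (simp add: block_sum_def cmat.scale_sum_right)
    also have "\<dots> \<in> cmat.span ?F"
      using kab by (intro cmat.span_scale cmat.span_base) force
    finally show "(\<Sum>i\<in>I k a. \<Sum>j\<in>I k b. ?g k i j) \<in> cmat.span ?F" .
  qed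
  finally show ?thesis .
qed

section \<open>The fusion criterion\<close>

theorem theorem3p2:
  fixes R :: "nat \<Rightarrow> ('x::finite \<times> 'x) set"
    and d e n :: nat
    and dm :: "nat \<Rightarrow> nat"
    and \<phi> :: "complex^'x^'x \<Rightarrow> nat \<times> nat \<times> nat \<Rightarrow> complex"
    and E :: "nat \<times> nat \<times> nat \<Rightarrow> complex^'x^'x"
    and p :: "nat \<Rightarrow> nat \<times> nat \<Rightarrow> nat \<Rightarrow> complex"
    and \<Lambda> :: "nat \<Rightarrow> nat set"
  assumes "association_scheme d R"
    and "wedderburn_iso (adjacency_algebra d R) n dm \<phi>"
    and "dual_basis (adjacency_algebra d R) n dm \<phi> E"
    and "\<forall>l\<in>{0..d}. adj_matrix (R l) =
           (\<Sum>(i, j, k)\<in>block_index n dm. p k (i, j) l *\<^sub>m E (i, j, k))"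
    and "indexed_partition {0..d} {0..e} \<Lambda>"
    and "\<Lambda> 0 = {0}"
    and a: "\<forall>l\<in>{0..e}. \<exists>k\<in>{0..e}.
           (\<Sum>l'\<in>\<Lambda> l. transpose (adj_matrix (R l'))) = (\<Sum>k'\<in>\<Lambda> k. adj_matrix (R k'))"
    and b: "\<exists>f C. (\<forall>k\<in>{1..n}. canonical_partition (dm k) (f k) (C k)) \<and>
           (\<Sum>k\<in>{1..n}. (f k)\<^sup>2) = e + 1 \<and>
           (\<forall>l\<in>{0..e}. \<forall>k\<in>{1..n}. \<forall>a\<in>{1..f k}. \<forall>b\<in>{1..f k}.
              \<forall>ij\<in>C k a b. \<forall>ij'\<in>C k a b.
                (\<Sum>l'\<in>\<Lambda> l. p k ij l') = (\<Sum>l'\<in>\<Lambda> l. p k ij' l'))"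
  shows "fusion_scheme d R e \<Lambda>"
proof -
  define S where "S = (\<lambda>l. \<Union>l'\<in>\<Lambda> l. R l')"
  have scheme: "d \<ge> 1" "\<And>i. i \<in> {0..d} \<Longrightarrow> R i \<noteq> {}" "adj_matrix (R 0) = mat 1"
    "(\<Sum>i\<in>{0..d}. adj_matrix (R i)) = (\<chi> x y. 1)"
    using assms(1) by (auto simp: association_scheme_def)
  note disjR = association_scheme_disjoint[OF assms(1)]
  note part = assms(5)
  note \<Lambda>_sub = indexed_partition_subset[OF part]

  have adj_S: "adj_matrix (S l) = (\<Sum>l'\<in>\<Lambda> l. adj_matrix (R l'))" if "l \<in> {0..e}" for l
    unfolding S_def using \<Lambda>_sub[OF that] disjR
    by (intro adj_matrix_UN) (auto intro: finite_subset disjoint_family_on_mono)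
  have S_nonempty: "S l \<noteq> {}" if "l \<in> {0..e}" for l
    using indexed_partition_nonempty[OF part that] \<Lambda>_sub[OF that] scheme(2)
    unfolding S_def by blast
  have S_disjoint: "disjoint_family_on S {0..e}"
    unfolding disjoint_family_on_def
  proof (intro ballI impI equals0I)
    fix l m z assume lm: "l \<in> {0..e}" "m \<in> {0..e}" "l \<noteq> m" "z \<in> S l \<inter> S m"
    then obtain l' m' where lm': "l' \<in> \<Lambda> l" "m' \<in> \<Lambda> m" "z \<in> R l'" "z \<in> R m'"
      by (auto simp: S_def)
    then have "l' = m'"
      using disjR \<Lambda>_sub[OF lm(1)] \<Lambda>_sub[OF lm(2)] unfolding disjoint_family_on_def by blast
    with lm lm' show False
      using indexed_partition_disjoint[OF part] unfolding disjoint_family_on_def by blast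
  qed
  let ?B = "(\<lambda>l. adj_matrix (S l)) ` {0..e}"
  have B_inj: "inj_on (\<lambda>l. adj_matrix (S l)) {0..e}"
    by (rule adj_matrix_disjoint_inj[OF S_disjoint S_nonempty])
  have S0: "adj_matrix (S 0) = mat 1"
    by (simp add: S_def assms(6) scheme(3))

  have e: "e \<ge> 1"
  proof (rule ccontr)
    assume "\<not> e \<ge> 1"
    then have "{0..e} = {0}" by simp
    then have "{0..d} = {0}"
      using indexed_partition_UN[OF part] assms(6) by simp
    then show False using scheme(1) by simp
  qed

  have S_sum: "(\<Sum>l\<in>{0..e}. adj_matrix (S l)) = (\<chi> x y. 1)"
    using scheme(4) sum_indexed_partition[OF part, of "\<lambda>i. adj_matrix (R i)"] adj_S by simp

  have S_transpose: "transpose (adj_matrix (S l)) \<in> (\<lambda>j. adj_matrix (S j)) ` {1..e}"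
    if l: "l \<in> {1..e}" for l
  proof -
    have tr: "transpose (adj_matrix (S l)) = (\<Sum>l'\<in>\<Lambda> l. transpose (adj_matrix (R l')))"
      using l by (simp add: adj_S transpose_def vec_eq_iff)
    obtain k where k: "k \<in> {0..e}" "transpose (adj_matrix (S l)) = adj_matrix (S k)"
      using a l tr adj_S by (metis atLeastAtMost_iff zero_le)
    \<comment> \<open>The identity is its own transpose, so only \<open>S 0\<close> can be sent to \<open>S 0\<close>.\<close>
    have "k \<noteq> 0"
    proof
      assume "k = 0"
      then have "adj_matrix (S l) = adj_matrix (S 0)"
        using k(2) S0 by (metis transpose_mat transpose_transpose)
      then show False using inj_onD[OF B_inj, of l 0] l by simp
    qed
    then show ?thesis using k by auto
  qed

  obtain f C where C: "\<And>k. k \<in> {1..n} \<Longrightarrow> canonical_partition (dm k) (f k) (C k)"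
    and card_f: "(\<Sum>k\<in>{1..n}. (f k)\<^sup>2) = e + 1"
    and const: "\<And>l k a b ij ij'. l \<in> {0..e} \<Longrightarrow> k \<in> {1..n} \<Longrightarrow> a \<in> {1..f k} \<Longrightarrow> b \<in> {1..f k} \<Longrightarrow>
      ij \<in> C k a b \<Longrightarrow> ij' \<in> C k a b \<Longrightarrow> (\<Sum>l'\<in>\<Lambda> l. p k ij l') = (\<Sum>l'\<in>\<Lambda> l. p k ij' l')"
    using b by blast
  obtain I where I: "\<And>k. k \<in> {1..n} \<Longrightarrow> indexed_partition {1..dm k} {1..f k} (I k)"
    and CI: "\<And>k a b. k \<in> {1..n} \<Longrightarrow> a \<in> {1..f k} \<Longrightarrow> b \<in> {1..f k} \<Longrightarrow> C k a b = I k a \<times> I k b"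
    using C unfolding canonical_partition_def by metis

  let ?K = "SIGMA k:{1..n}. {1..f k} \<times> {1..f k}"
  let ?F = "(\<lambda>(k, a, b). block_sum E I k a b) ` ?K"
  have B_in_F: "adj_matrix (S l) \<in> cmat.span ?F" if l: "l \<in> {0..e}" for l
  proof -
    have "adj_matrix (S l) = (\<Sum>l'\<in>\<Lambda> l. \<Sum>(i, j, k)\<in>block_index n dm. p k (i, j) l' *\<^sub>m E (i, j, k))"
      using adj_S[OF l] \<Lambda>_sub[OF l] assms(4) by (auto intro!: sum.cong)
    also have "\<dots> = (\<Sum>(i, j, k)\<in>block_index n dm. (\<Sum>l'\<in>\<Lambda> l. p k (i, j) l') *\<^sub>m E (i, j, k))"
      by (subst sum.swap) (auto intro!: sum.cong simp: cmat.scale_sum_left)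
    also have "\<dots> \<in> cmat.span ?F"
    proof (rule block_constant_sum_in_span[OF I, where q="\<lambda>k ij. \<Sum>l'\<in>\<Lambda> l. p k ij l'"])
      fix k a b ij ij'
      assume "k \<in> {1..n}" "a \<in> {1..f k}" "b \<in> {1..f k}" "ij \<in> I k a \<times> I k b" "ij' \<in> I k a \<times> I k b"
      then show "(\<Sum>l'\<in>\<Lambda> l. p k ij l') = (\<Sum>l'\<in>\<Lambda> l. p k ij' l')"
        using const[OF l, of k a b ij ij'] by (simp only: CI)
    qed
    finally show ?thesis .
  qed
  have "card ?F \<le> card ?K"
    by (intro card_image_le) auto
  also have "\<dots> = card ?B"
    using card_f by (simp add: card_image[OF B_inj] power2_eq_square)
  finally have F_in_B: "cmat.span ?F \<subseteq> cmat.span ?B"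
    using B_in_F adj_matrix_disjoint_independent[OF _ S_disjoint S_nonempty]
    by (intro span_subset_independent_card) auto

  have unit: "E (i, j, k) ** E (i', j', k') = (if k = k' \<and> j = i' then E (i, j', k) else 0)"
    if "(i, j, k) \<in> block_index n dm" "(i', j', k') \<in> block_index n dm" for i j k i' j' k'
    using assms(3) that unfolding dual_basis_def by fast
  have F_mult: "M ** N \<in> cmat.span ?F" if M: "M \<in> ?F" and N: "N \<in> ?F" for M N
  proof -
    obtain k a b where M: "k \<in> {1..n}" "a \<in> {1..f k}" "b \<in> {1..f k}" "M = block_sum E I k a b"
      using M by auto
    obtain k' a' b' where N: "k' \<in> {1..n}" "a' \<in> {1..f k'}" "b' \<in> {1..f k'}"
      "N = block_sum E I k' a' b'"
      using N by auto
    have "block_sum E I k a b' \<in> ?F" if "k = k'"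
      using M N that by force
    then have "(if k = k' \<and> b = a' then of_nat (card (I k b)) *\<^sub>m block_sum E I k a b' else 0)
        \<in> cmat.span ?F"
      by (simp add: cmat.span_scale cmat.span_base cmat.span_zero del: mem_Sigma_iff)
    moreover have "M ** N =
        (if k = k' \<and> b = a' then of_nat (card (I k b)) *\<^sub>m block_sum E I k a b' else 0)"
      unfolding M(4) N(4) by (rule block_sum_mult[where n=n, OF unit I]) (assumption | rule M(1-3) N(1-3))+
    ultimately show ?thesis by simp
  qed
  have "adj_matrix (S i) ** adj_matrix (S j) \<in> cmat.span ?B" if "i \<in> {0..e}" "j \<in> {0..e}" for i j
    using span_mult_closed[OF F_mult B_in_F[OF that(1)] B_in_F[OF that(2)]] F_in_B by blast
  then have "association_scheme e S"
    using e S_nonempty S0 S_sum S_transpose by (simp add: association_scheme_def)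
  then show ?thesis
    using assms(1) part by (simp add: fusion_scheme_def S_def)
qed

end
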